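(* Let $V_n$ ($n\ge 1$) be the supervector of the $n$-th generation supertiles of the hat tile whose short edge has length $1$, and let $V_0=3V_1-V_2$, as defined in the context. Then $$V_n=\left(F_{2n},\ \sqrt{3}\,L_{2n}\right)\qquad\text{for all } n\ge 0 .$$ Moreover, for every $n\ge 1$, the $n$-th generation of supertiles rotates from the $(n-1)$-th by an angle of $\operatorname{arccot}(G_n\sqrt{3})$ (that is, the clockwise angle from the direction of $V_{n-1}$ to the direction of $V_n$ equals $\operatorname{arccot}(G_n\sqrt3)$), where $$G_n=\frac{8L_{4n-2}+21}{15}.$$
   Context: $F_n$ is the Fibonacci sequence ($F_0=0$, $F_1=1$, $F_{n}=F_{n-1}+F_{n-2}$) and $L_n$ the Lucas sequence ($L_0=2$, $L_1=1$, $L_n=L_{n-1}+L_{n-2}$). The function $\operatorname{arccot}$ of a positive number takes values in $(0,\pi/2)$. Identify the plane with $\mathbb{C}$, $(x,y)\leftrightarrow x+iy$, and put $\omega=e^{i\pi/3}$. The supertiles of the hat tile (the aperiodic monotile $\mathrm{Tile}(1,\sqrt3)$, short edge $1$) come in two types in each generation $m\ge1$: hat-$m$ and thc-$m$ (two-hat compound). Hat-1 is a single hat and thc-1 is the two-hat compound. Every supertile of generation $m$ carries a directed segment, its supervector, whose start and end are called its tail and head; it is the same vector for hat-$m$ and thc-$m$. In standard orientation it is the vector $V_m$, with complex number $v_m$. A copy of a generation-$m$ supertile with rotation $u$ ($u\in\mathbb{C}$, $|u|=1$) and tail $p$ has supervector from $p$ to $p+u\,v_m$. Only these markings are needed. Composition.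 For $m\ge2$, a hat-$m$ of rotation $u$ consists of one thc-$(m-1)$, called $C$, and six hat-$(m-1)$'s, called $H_1,\dots,H_6$, placed as follows. $C$ has rotation $u$; call its tail $o$. $H_1$ has tail $o$ and rotation $u\omega^{-2}$. $H_2$ has its tail at the head of $H_1$ and rotation $u\omega^{-1}$. $H_3$ has its tail at the head of $H_2$ and rotation $u$. $H_4$ has rotation $u$ and is placed between $C$ and $H_3$. $H_5$ has its tail at the head of $H_4$ and rotation $u\omega$. $H_6$ has its tail at the head of $H_5$ and rotation $u\omega^2$. A thc-$m$ is the same except that $H_3$ is missing. For $m\ge3$ the position of $H_4$ is determined by this rule: the supervector of the constituent thc-$(m-2)$ of $H_4$ lies exactly where the supervector of the missing third hat-$(m-2)$ (the missing $H_3$) of $C$, a thc-$(m-1)$, would be. Supervectors. - Generation 1: $V_1=(1,3\sqrt3)$. - Generation 2: $V_2=(3,7\sqrt3)$, and in a generation-2 supertile of rotation $u$ the tail of the supervector is at $o+u\,T_2$ with $T_2=2-2\sqrt3\,i$, where $o$ is the tail of its constituent thc-1. - Generation $m\ge3$: the supervector starts at the head of the third hat-$(m-2)$ (the $H_3$ constituent) of the first hat-$(m-1)$ (i.e. $H_1$) and ends at the head of the third hat-$(m-2)$ of the fifth hat-$(m-1)$ (i.e. $H_5$). The vector $V_m$ is this vector when $u=1$. Finally, $V_0:=3V_1-V_2=(0,2\sqrt3)$. *)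

theory Defs
  imports "HOL-Analysis.Analysis" "HOL-Number_Theory.Fib"
begin

fun lucas :: "nat \<Rightarrow> nat" where
  "lucas 0 = 2"
| "lucas (Suc 0) = 1"
| "lucas (Suc (Suc n)) = lucas (Suc n) + lucas n"

text \<open>Only meaningful for positive arguments, where the value lies in the open
  interval from 0 to \<open>pi / 2\<close>.\<close>

definition arccot :: "real \<Rightarrow> real" where
  "arccot x = (THE y. 0 < y \<and> y < pi / 2 \<and> cot y = x)"

text \<open>The clockwise angle, in the interval from 0 (inclusive) to \<open>2 * pi\<close> (exclusive), from the
  direction of \<open>a\<close> to the direction of \<open>b\<close>: \<open>Arg2pi\<close> measures counterclockwise, so the
  arguments are swapped in the quotient.\<close>

definition clockwise_angle :: "complex \<Rightarrow> complex \<Rightarrow> real" where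
  "clockwise_angle a b = Arg2pi (a / b)"

definition G :: "nat \<Rightarrow> real" where
  "G n = (8 * real (lucas (4 * n - 2)) + 21) / 15"

definition \<omega> :: complex where
  "\<omega> = cis (pi / 3)"

datatype kind = Hat | Thc

text \<open>A supertile placed in the plane: \<open>rot\<close> is its rotation and \<open>tail\<close> the tail of its
  supervector.\<close>

datatype supertile =
  Supertile (kind: kind) (gen: nat) (rot: complex) (tail: complex)

text \<open>
  \<open>v m\<close> is the supervector of generation \<open>m\<close> in standard orientation.  The other two parameters
  are positions relative to the tail \<open>o\<close> of the constituent two-hat compound \<open>C\<close>, in standard
  orientation: \<open>t m\<close> is the tail of the supervector of the supertile itself, \<open>q m\<close> the tail of
  its constituent \<open>H\<^sub>4\<close>.  The constituents only make sense for generation at least 2.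
  The slot \<open>hat3\<close> is also defined for a supertile of kind \<open>Thc\<close>, where it is the place of
  the missing third hat.\<close>

locale supertile_markings =
  fixes v t q :: "nat \<Rightarrow> complex"
begin

definition head :: "supertile \<Rightarrow> complex" where
  "head X = tail X + rot X * v (gen X)"

definition supervector :: "supertile \<Rightarrow> complex \<times> complex" where
  "supervector X = (tail X, head X)"

definition origin :: "supertile \<Rightarrow> complex" where
  "origin X = tail X - rot X * t (gen X)"

definition compound :: "supertile \<Rightarrow> supertile" where
  "compound X = Supertile Thc (gen X - 1) (rot X) (origin X)"

definition hat1 :: "supertile \<Rightarrow> supertile" where
  "hat1 X = Supertile Hat (gen X - 1) (rot X * \<omega> powi (-2)) (origin X)"

definition hat2 :: "supertile \<Rightarrow> supertile" where
  "hat2 X = Supertile Hat (gen X - 1) (rot X * \<omega> powi (-1)) (head (hat1 X))"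

definition hat3 :: "supertile \<Rightarrow> supertile" where
  "hat3 X = Supertile Hat (gen X - 1) (rot X) (head (hat2 X))"

definition hat4 :: "supertile \<Rightarrow> supertile" where
  "hat4 X = Supertile Hat (gen X - 1) (rot X) (origin X + rot X * q (gen X))"

definition hat5 :: "supertile \<Rightarrow> supertile" where
  "hat5 X = Supertile Hat (gen X - 1) (rot X * \<omega>) (head (hat4 X))"

definition hat6 :: "supertile \<Rightarrow> supertile" where
  "hat6 X = Supertile Hat (gen X - 1) (rot X * \<omega>\<^sup>2) (head (hat5 X))"

definition constituents :: "supertile \<Rightarrow> supertile list" where
  "constituents X = (case kind X of
      Hat \<Rightarrow> [compound X, hat1 X, hat2 X, hat3 X, hat4 X, hat5 X, hat6 X]
    | Thc \<Rightarrow> [compound X, hat1 X, hat2 X, hat4 X, hat5 X, hat6 X])"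

end

text \<open>
  The rules that determine the markings.  Nothing is said about \<open>t\<close> and \<open>q\<close> below generations
  2 and 3, respectively: generation 1 has no constituents, and the position of \<open>H\<^sub>4\<close> in
  generation 2 is not needed.  The value \<open>v 0\<close> is not a supervector but fixed by convention.\<close>

locale hat_supertiles = supertile_markings v t q for v t q +
  assumes v_0: "v 0 = 3 * v 1 - v 2"
    and v_1: "v 1 = Complex 1 (3 * sqrt 3)"
    and v_2: "v 2 = Complex 3 (7 * sqrt 3)"
    and t_2: "t 2 = Complex 2 (- 2 * sqrt 3)"
    and hat4_rule: "\<And>X. \<lbrakk>norm (rot X) = 1; gen X \<ge> 3\<rbrakk> \<Longrightarrow>
          supervector (compound (hat4 X)) = supervector (hat3 (compound X))"
    and supervector_rule: "\<And>X. \<lbrakk>norm (rot X) = 1; gen X \<ge> 3\<rbrakk> \<Longrightarrow>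
          supervector X = (head (hat3 (hat1 X)), head (hat3 (hat5 X)))"

text \<open>The rules are consistent.\<close>

fun markings :: "nat \<Rightarrow> complex \<times> complex" where
  "markings 0 = (Complex 0 (2 * sqrt 3), 0)"
| "markings (Suc 0) = (Complex 1 (3 * sqrt 3), 0)"
| "markings (Suc (Suc 0)) = (Complex 3 (7 * sqrt 3), Complex 2 (- 2 * sqrt 3))"
| "markings (Suc (Suc (Suc n))) =
    (let v1 = fst (markings (Suc n)); v2 = fst (markings (Suc (Suc n)));
         t2 = snd (markings (Suc (Suc n)));
         s = \<omega> powi (-2) + \<omega> powi (-1);
         third = (\<lambda>r p. p - r * t2 + r * (s + 1) * v1);
         tl = third (\<omega> powi (-2)) 0
     in (third \<omega> (s * v1 + v2) - tl, tl))"

lemma hat_supertiles_exist: "\<exists>v t q. hat_supertiles v t q"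
proof -
  define v where "v = (\<lambda>n. fst (markings n))"
  define t where "t = (\<lambda>n. snd (markings n))"
  define q where "q = (\<lambda>n. (\<omega> powi (-2) + \<omega> powi (-1)) * v (n - 2))"
  interpret supertile_markings v t q .
  note geo = supervector_def head_def origin_def compound_def hat1_def hat2_def hat3_def
    hat4_def hat5_def
  have "hat_supertiles v t q"
  proof
    fix X :: supertile
    assume "3 \<le> gen X"
    then obtain n where n: "gen X = Suc (Suc (Suc n))"
      by (metis One_nat_def Suc_le_D numeral_3_eq_3 Suc_le_mono)
    show "supervector (compound (hat4 X)) = supervector (hat3 (compound X))"
      unfolding geo by (simp add: n q_def algebra_simps)
    show "supervector X = (head (hat3 (hat1 X)), head (hat3 (hat5 X)))"
      unfolding geo by (simp add: n q_def v_def t_def Let_def algebra_simps)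
  qed (simp_all add: v_def t_def numeral_2_eq_2 complex_eq_iff)
  then show ?thesis by blast
qed

end

theory Submission
  imports Defs
begin

text \<open>With \<open>\<omega>\<^sup>2 = \<omega> - 1\<close> the composition rules become linear recurrences for \<open>v\<close> and for the
  offset \<open>t\<close>. The relation \<open>t (n + 2) = v n / \<omega> - v (n + 1)\<close> is invariant and decouples them into
  \<open>v (n + 2) = 3 v (n + 1) - v n\<close>, the recurrence of the even-indexed Fibonacci and Lucas numbers.
  For the angle, \<open>v (n - 1) * cnj (v n)\<close> has the constant imaginary part \<open>2 * sqrt 3\<close>, so that its
  real part, which product formulas express by \<open>lucas (4 * n - 2)\<close>, determines the cotangent.\<close>

lemma omega_square: "\<omega>\<^sup>2 = \<omega> - 1"
  by (simp add: \<omega>_def complex_eq_iff power2_eq_square cos_60 sin_60)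

lemma inverse_omega: "inverse \<omega> = 1 - \<omega>"
proof (rule inverse_unique)
  show "\<omega> * (1 - \<omega>) = 1"
    using omega_square by (simp add: algebra_simps power2_eq_square)
qed

lemma omega_powi_minus_two: "\<omega> powi (-2) = - \<omega>"
  by (simp add: power_int_minus flip: power_inverse)
    (simp add: inverse_omega power2_diff omega_square)

lemma arccot_eqI:
  assumes "0 < y" "y < pi / 2" "cot y = x"
  shows "arccot x = y"
  unfolding arccot_def
proof (rule the_equality)
  fix z assume z: "0 < z \<and> z < pi / 2 \<and> cot z = x"
  then have "tan z = tan y"
    using assms(3) by (simp add: tan_altdef)
  moreover have "z = arctan (tan z)" "y = arctan (tan y)"
    using z assms by (intro arctan_unique[symmetric]; simp)+
  ultimately show "z = y" by simp
qed (use assms in auto)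

text \<open>The quotient \<open>a / b\<close> is \<open>a * cnj b\<close> divided by the positive
  real \<open>(cmod b)\<^sup>2\<close>, so both have the same \<open>Arg2pi\<close>; positive real
  and imaginary parts put it in the first quadrant.\<close>

lemma clockwise_angle_eq_arccot:
  assumes "0 < Re (a * cnj b)" "0 < Im (a * cnj b)"
  shows "clockwise_angle a b = arccot (Re (a * cnj b) / Im (a * cnj b))"
proof -
  define z where "z = a * cnj b"
  define \<phi> where "\<phi> = Arg2pi z"
  have "b \<noteq> 0" using assms by auto
  have "a / b = z / of_real ((cmod b)\<^sup>2)"
    unfolding z_def by (rule complex_div_cnj)
  then have angle: "clockwise_angle a b = \<phi>"
    using \<open>b \<noteq> 0\<close> by (simp add: clockwise_angle_def \<phi>_def del: of_real_power)
  have re: "cmod z * cos \<phi> = Re z" and im: "cmod z * sin \<phi> = Im z"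
    by (simp_all add: \<phi>_def cos_Arg2pi sin_Arg2pi)
  have pos: "0 < cmod z" using assms by (auto simp: z_def)
  have "0 < \<phi>" "\<phi> < pi"
    using assms Arg2pi_lt_pi[of z] by (auto simp: \<phi>_def z_def)
  moreover have "0 < cos \<phi>"
    using re pos assms(1) by (metis z_def zero_less_mult_pos)
  ultimately have "\<phi> < pi / 2"
    using cos_monotone_0_pi_le[of "pi / 2" \<phi>] by force
  moreover have "cot \<phi> = Re z / Im z"
    unfolding cot_def re[symmetric] im[symmetric] using pos by simp
  ultimately show ?thesis
    using \<open>0 < \<phi>\<close> by (simp add: angle arccot_eqI z_def)
qed

text \<open>Cassini's identity at even indices, where its sign is constant. The product identities
  below all reduce to it.\<close>

lemma fib_even_Cassini:
  "(real (fib (Suc (2 * n))))\<^sup>2 = real (fib (Suc (2 * n))) * real (fib (2 * n)) + (real (fib (2 * n)))\<^sup>2 + 1"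
  by (induction n) (simp_all add: power2_eq_square algebra_simps)

lemma lucas_fib: "real (lucas n) = 2 * real (fib (Suc n)) - real (fib n)"
  by (induction n rule: lucas.induct) simp_all

text \<open>Writing everything in terms of \<open>fib (2 * n)\<close> and
  \<open>fib (Suc (2 * n))\<close> turns the identities below into polynomial consequences of
  Cassini.\<close>

lemma fib_lucas_even:
  "real (fib (2 * n + 2)) = real (fib (Suc (2 * n))) + real (fib (2 * n))"
  "real (lucas (2 * n)) = 2 * real (fib (Suc (2 * n))) - real (fib (2 * n))"
  "real (lucas (2 * n + 2)) = 3 * real (fib (Suc (2 * n))) + real (fib (2 * n))"
  by (simp_all add: lucas_fib)

lemma supervector_Im_product:
  "real (lucas (2 * n)) * real (fib (2 * n + 2)) - real (fib (2 * n)) * real (lucas (2 * n + 2)) = 2"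
  using fib_even_Cassini[of n] unfolding fib_lucas_even by algebra

lemma lucas_4n_plus_2:
  "real (lucas (4 * n + 2)) = 5 * real (fib (2 * n)) * real (fib (2 * n + 2)) + 3"
proof -
  define k where "k = 2 * n"
  \<comment> \<open>The addition formula \<open>fib_add\<close> halves the index, which makes the
    Lucas number a quadratic form in two consecutive Fibonacci numbers.\<close>
  have 1: "fib (2 * k + 2) = fib (Suc (Suc k)) * fib (Suc k) + fib (Suc k) * fib k"
    using fib_add[of "Suc k" k] by (simp add: mult_2)
  have 2: "fib (2 * k + 3) = (fib (Suc (Suc k)))\<^sup>2 + (fib (Suc k))\<^sup>2"
    using fib_add[of "Suc k" "Suc k"] by (simp add: mult_2 numeral_3_eq_3 power2_eq_square)
  have "lucas (4 * n + 2) = 2 * real (fib (2 * k + 3)) - real (fib (2 * k + 2))"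
    by (simp add: lucas_fib k_def numeral_3_eq_3)
  also have "\<dots> = 2 * ((real (fib (Suc k)) + real (fib k))\<^sup>2 + (real (fib (Suc k)))\<^sup>2)
      - ((real (fib (Suc k)) + real (fib k)) * real (fib (Suc k)) + real (fib (Suc k)) * real (fib k))"
    unfolding 1 2 by simp
  \<comment> \<open>The quadratic forms on the two sides differ by three times the Cassini form,
    whence the constant 3.\<close>
  also have "\<dots> = 5 * real (fib k) * (real (fib (Suc k)) + real (fib k)) + 3"
    using fib_even_Cassini[of n] unfolding k_def by algebra
  finally show ?thesis
    unfolding k_def fib_lucas_even .
qed

lemma supervector_Re_product:
  "real (fib (2 * n)) * real (fib (2 * n + 2)) + 3 * (real (lucas (2 * n)) * real (lucas (2 * n + 2)))
    = (16 * real (lucas (4 * n + 2)) + 42) / 5"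
proof -
  have "5 * (real (fib (2 * n)) * real (fib (2 * n + 2))
      + 3 * (real (lucas (2 * n)) * real (lucas (2 * n + 2)))) = 16 * real (lucas (4 * n + 2)) + 42"
    using fib_even_Cassini[of n] unfolding lucas_4n_plus_2 fib_lucas_even by algebra
  then show ?thesis by simp
qed

context hat_supertiles
begin

lemmas geometry = supervector_def head_def origin_def compound_def hat1_def hat2_def hat3_def
  hat4_def hat5_def inverse_omega omega_powi_minus_two

text \<open>\<open>H\<^sub>4\<close> and \<open>C\<close> have the same rotation, so their offsets
  \<open>t (n + 2)\<close> cancel. What remains is the walk along the first two hats of
  \<open>C\<close>, with
  \<open>\<omega> powi (-2) + \<omega> powi (-1) = 1 - 2 * \<omega>\<close>.\<close>

lemma q_recurrence: "q (n + 3) = (1 - 2 * \<omega>) * v (n + 1)"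
  using hat4_rule[of "Supertile Hat (n + 3) 1 0"]
  by (simp add: geometry algebra_simps)

lemma t_recurrence: "t (n + 3) = \<omega> * t (n + 2) - 2 * v (n + 1)"
proof -
  \<comment> \<open>The factor \<open>- \<omega>\<close> is the rotation of
    \<open>H\<^sub>1\<close>, and \<open>2 - 2 * \<omega>\<close> adds up the rotations of its first
    three hats.\<close>
  have "t (n + 3) = - \<omega> * ((2 - 2 * \<omega>) * v (n + 1) - t (n + 2))"
    using supervector_rule[of "Supertile Hat (n + 3) 1 0"]
    by (simp add: geometry algebra_simps)
  also have "\<dots> = \<omega> * t (n + 2) - 2 * (\<omega> - \<omega>\<^sup>2) * v (n + 1)"
    by (simp add: algebra_simps power2_eq_square)
  finally show ?thesis by (simp add: omega_square)
qed

text \<open>The rotation \<open>\<omega>\<close> of \<open>H\<^sub>5\<close> is the negative of that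
  of \<open>H\<^sub>1\<close>. Hence the displacement from its tail to the head of its third hat is
  \<open>- t (n + 3)\<close>, which doubles the offset.\<close>

lemma v_recurrence_offset: "v (n + 3) = (1 - 2 * \<omega>) * v (n + 1) + v (n + 2) - 2 * t (n + 3)"
proof -
  have "v (n + 3) = - t (n + 3) + q (n + 3) + v (n + 2) + \<omega> * ((2 - 2 * \<omega>) * v (n + 1) - t (n + 2))"
    using supervector_rule[of "Supertile Hat (n + 3) 1 0"]
    by (simp add: geometry algebra_simps)
  also have "\<dots> = q (n + 3) + v (n + 2) - t (n + 3) - (\<omega> * t (n + 2) - 2 * (\<omega> - \<omega>\<^sup>2) * v (n + 1))"
    by (simp add: algebra_simps power2_eq_square)
  also have "\<dots> = q (n + 3) + v (n + 2) - t (n + 3) - t (n + 3)"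
    by (simp add: omega_square t_recurrence)
  finally show ?thesis by (simp add: q_recurrence)
qed

text \<open>The two halves need a joint induction: the step for \<open>t\<close> uses the recurrence
  for \<open>v\<close>, and the step for \<open>v\<close> uses the new value of
  \<open>t\<close>.\<close>

lemma offset_invariant:
  "v (n + 2) = 3 * v (n + 1) - v n \<and> t (n + 2) = (1 - \<omega>) * v n - v (n + 1)"
proof (induction n)
  case 0
  \<comment> \<open>The given \<open>t 2\<close> is exactly the value that makes the invariant hold
    at the start with the conventional \<open>v 0\<close>.\<close>
  have "t 2 = (1 - \<omega>) * v 0 - v 1"
    unfolding v_0 v_1 v_2 t_2
    by (simp add: \<omega>_def complex_eq_iff cos_60 sin_60)
  then show ?case
    by (simp add: v_0 numeral_2_eq_2)
next
  case (Suc n)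
  have "t (n + 3) = \<omega> * ((1 - \<omega>) * v n - v (n + 1)) - 2 * v (n + 1)"
    using Suc by (simp only: t_recurrence)
  also have "\<dots> = (\<omega> - \<omega>\<^sup>2) * v n - (\<omega> + 2) * v (n + 1)"
    by (simp add: algebra_simps power2_eq_square)
  also have "\<dots> = (1 - \<omega>) * v (n + 1) - v (n + 2)"
    using Suc by (simp add: omega_square algebra_simps)
  finally have t: "t (n + 3) = (1 - \<omega>) * v (n + 1) - v (n + 2)" .
  \<comment> \<open>The multiples of \<open>\<omega>\<close> cancel here, leaving integer
    coefficients.\<close>
  have "v (n + 3) = 3 * v (n + 2) - v (n + 1)"
    unfolding v_recurrence_offset t by (simp add: algebra_simps)
  with t show ?case by (simp add: numeral_3_eq_3)
qed

lemma v_closed_form: "v n = Complex (real (fib (2 * n))) (sqrt 3 * real (lucas (2 * n)))"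
proof (induction n rule: fib.induct)
  case 1
  show ?case unfolding v_0 v_1 v_2 by (simp add: complex_eq_iff)
next
  case 2
  show ?case using v_1 by (simp add: complex_eq_iff numeral_2_eq_2)
next
  case (3 n)
  then show ?case
    using offset_invariant[of n] by (simp add: complex_eq_iff algebra_simps)
qed

end

theorem mainTheorem1:
  fixes v t q :: "nat \<Rightarrow> complex"
  assumes "hat_supertiles v t q"
  shows "(\<forall>n. v n = Complex (real (fib (2 * n))) (sqrt 3 * real (lucas (2 * n)))) \<and>
         (\<forall>n\<ge>1. clockwise_angle (v (n - 1)) (v n) = arccot (G n * sqrt 3))"
proof (intro conjI allI impI)
  interpret hat_supertiles v t q by fact
  show closed: "v n = Complex (real (fib (2 * n))) (sqrt 3 * real (lucas (2 * n)))" for n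
    by (rule v_closed_form)
  fix n :: nat assume "n \<ge> 1"
  \<comment> \<open>The shift removes truncated subtraction: \<open>n - 1\<close> becomes
    \<open>k\<close> and \<open>4 * n - 2\<close> becomes \<open>4 * k + 2\<close>.\<close>
  then obtain k where n: "n = Suc k" by (cases n) auto
  let ?z = "v k * cnj (v (Suc k))"
  have im: "Im ?z = 2 * sqrt 3"
  proof -
    have "Im ?z = sqrt 3 * (real (lucas (2 * k)) * real (fib (2 * k + 2))
        - real (fib (2 * k)) * real (lucas (2 * k + 2)))"
      unfolding closed by (simp add: algebra_simps)
    then show ?thesis by (simp only: supervector_Im_product)
  qed
  have re: "Re ?z = 6 * G n"
  proof -
    have "sqrt 3 * (sqrt 3 * x) = 3 * x" for x
      by (simp flip: mult.assoc)
    note this [simp]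
    have "Re ?z = real (fib (2 * k)) * real (fib (2 * k + 2))
        + 3 * (real (lucas (2 * k)) * real (lucas (2 * k + 2)))"
      unfolding closed by (simp add: algebra_simps)
    also have "\<dots> = 6 * G n"
      unfolding supervector_Re_product by (simp add: G_def n)
    finally show ?thesis .
  qed
  have "0 < G n" by (simp add: G_def add_nonneg_pos)
  then have "clockwise_angle (v k) (v (Suc k)) = arccot (6 * G n / (2 * sqrt 3))"
    using clockwise_angle_eq_arccot[of "v k" "v (Suc k)"] by (simp only: re im) simp
  also have "6 * G n / (2 * sqrt 3) = G n * sqrt 3"
    by (simp add: field_simps)
  finally show "clockwise_angle (v (n - 1)) (v n) = arccot (G n * sqrt 3)"
    by (simp add: n)
qed

end
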